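(* Let $G$ be a graph, and let $H$ be a neighborhood-minor of $G$. Then $\mathbb{K}[H]$ is an algebra retract of $\mathbb{K}[G]$.
   Context: $\mathbb{K}$ is a field. All graphs are finite and simple with non-empty vertex set. For a graph $G=(V,E)$ let $S_G=\mathbb{K}[q_{A|B}]$ be the polynomial ring with one variable for each unordered partition $A|B$ of $V$ (i.e. $A\cup B=V$, $A\cap B=\emptyset$, empty parts allowed), and $R_G=\mathbb{K}[s_{ij},t_{ij}:\{i,j\}\in E]$. Let $\mathrm{Cut}(A|B)\subseteq E$ be the set of edges with one endpoint in $A$ and the other in $B$. Let $\phi_G\colon S_G\to R_G$ be the $\mathbb{K}$-algebra homomorphism $q_{A|B}\mapsto u_{A|B}:=\prod_{\{i,j\}\in \mathrm{Cut}(A|B)}s_{ij}\prod_{\{i,j\}\in E\setminus \mathrm{Cut}(A|B)}t_{ij}$. The cut algebra $\mathbb{K}[G]\cong S_G/\ker\phi_G$ is the image of $\phi_G$, i.e. the $\mathbb{K}$-subalgebra of $R_G$ generated by the monomials $u_{A|B}$; it is standard graded with $\deg u_{A|B}=1$ (if $G$ has no edges, $\mathbb{K}[G]=\mathbb{K}$, concentrated in degree $0$). For $v\in V$, $N_G(v)$ is the set of neighbors of $v$ in $G$, $N_G[v]=N_G(v)\cup\{v\}$, and $N_G(T)=\bigcup_{v\in T}N_G(v)$ for non-empty $T\subseteq V$. $G_W$ denotes the induced subgraph of $G$ on $W$. Neighborhood-minor: let $V=W\cup W'$ with $W\cap W'=\emptyset$ and $W,W'\neq\emptyset$, and let $H=G_W$.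 If there exists a vertex $v\in W$ with $W\cap N_G(W')\subseteq N_H[v]$, then $H$ is called a neighborhood-minor of $G$. Algebra retract: for graded $\mathbb{K}$-algebras $A,B$, $A$ is an algebra retract of $B$ if there exist an injective homogeneous $\mathbb{K}$-algebra homomorphism $\iota\colon A\to B$ and a homogeneous (surjective) $\mathbb{K}$-algebra homomorphism $\pi\colon B\to A$ with $\pi\circ\iota=\mathrm{id}_A$ (the homogeneous homomorphisms are not required to be of degree $0$). *)

theory Defs
  imports "HOL-Library.Poly_Mapping"
begin

section \<open>Graphs\<close>

datatype 'a graph = Graph (verts: "'a set") (edges: "'a set set")

definition simple_graph :: "'a graph \<Rightarrow> bool" where
  "simple_graph G \<longleftrightarrow>
     finite (verts G) \<and> verts G \<noteq> {} \<and> (\<forall>e\<in>edges G. e \<subseteq> verts G \<and> card e = 2)"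

definition induced_subgraph :: "'a graph \<Rightarrow> 'a set \<Rightarrow> 'a graph" where
  "induced_subgraph G W = Graph W {e \<in> edges G. e \<subseteq> W}"

definition nbrs :: "'a graph \<Rightarrow> 'a \<Rightarrow> 'a set" where
  "nbrs G v = {w. {v, w} \<in> edges G}"

definition closed_nbrs :: "'a graph \<Rightarrow> 'a \<Rightarrow> 'a set" where
  "closed_nbrs G v = nbrs G v \<union> {v}"

definition set_nbrs :: "'a graph \<Rightarrow> 'a set \<Rightarrow> 'a set" where
  "set_nbrs G T = (\<Union>v\<in>T. nbrs G v)"

definition neighborhood_minor :: "'a graph \<Rightarrow> 'a graph \<Rightarrow> bool" where
  "neighborhood_minor H G \<longleftrightarrow>
     (\<exists>W W'. verts G = W \<union> W' \<and> W \<inter> W' = {} \<and> W \<noteq> {} \<and> W' \<noteq> {} \<and>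
             H = induced_subgraph G W \<and>
             (\<exists>v\<in>W. W \<inter> set_nbrs G W' \<subseteq> closed_nbrs H v))"

section \<open>Multivariate polynomials\<close>

text \<open>
  Polynomials over \<open>'k\<close> in variables from \<open>'x\<close>, as the monoid algebra of the finitely
  supported exponent vectors; \<open>polys X\<close> is the polynomial ring with variable set \<open>X\<close>.
\<close>

type_synonym ('x, 'k) mpoly = "('x \<Rightarrow>\<^sub>0 nat) \<Rightarrow>\<^sub>0 'k"

definition Const :: "'k::field \<Rightarrow> ('x, 'k) mpoly" where
  "Const c = Poly_Mapping.single 0 c"

definition Var :: "'x \<Rightarrow> ('x, 'k::field) mpoly" where
  "Var x = Poly_Mapping.single (Poly_Mapping.single x 1) 1"

definition polys :: "'x set \<Rightarrow> ('x, 'k::field) mpoly set" where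
  "polys X = {p. \<forall>m\<in>Poly_Mapping.keys p. Poly_Mapping.keys m \<subseteq> X}"

definition mon_degree :: "('x \<Rightarrow>\<^sub>0 nat) \<Rightarrow> nat" where
  "mon_degree m = (\<Sum>x\<in>Poly_Mapping.keys m. Poly_Mapping.lookup m x)"

definition homog_polys :: "'x set \<Rightarrow> nat \<Rightarrow> ('x, 'k::field) mpoly set" where
  "homog_polys X d = {p \<in> polys X. \<forall>m\<in>Poly_Mapping.keys p. mon_degree m = d}"

text \<open>The \<open>'k\<close>-algebra homomorphism sending \<open>Var x\<close> to \<open>g x\<close>.\<close>

definition subst :: "('x \<Rightarrow> ('y, 'k) mpoly) \<Rightarrow> ('x, 'k::field) mpoly \<Rightarrow> ('y, 'k) mpoly" where
  "subst g p =
     (\<Sum>m\<in>Poly_Mapping.keys p. Const (Poly_Mapping.lookup p m) *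
        (\<Prod>x\<in>Poly_Mapping.keys m. g x ^ Poly_Mapping.lookup m x))"

section \<open>Graded algebras and algebra retracts\<close>

text \<open>
  Graded \<open>'k\<close>-algebras are given inside a polynomial ring: a carrier together with its
  graded components.
\<close>

datatype 'p graded_alg = Graded (carr: "'p set") (component: "nat \<Rightarrow> 'p set")

definition alg_hom ::
  "('x, 'k::field) mpoly graded_alg \<Rightarrow> ('y, 'k) mpoly graded_alg \<Rightarrow>
   (('x, 'k) mpoly \<Rightarrow> ('y, 'k) mpoly) \<Rightarrow> bool" where
  "alg_hom A B f \<longleftrightarrow>
     f ` carr A \<subseteq> carr B \<and>
     (\<forall>c. f (Const c) = Const c) \<and>
     (\<forall>p\<in>carr A. \<forall>q\<in>carr A. f (p + q) = f p + f q \<and> f (p * q) = f p * f q)"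

text \<open>
  Homomorphisms of arbitrary degree: homogeneous elements of a common degree go to
  homogeneous elements of a common degree, which may be different.
\<close>

definition homogeneous_map ::
  "'p graded_alg \<Rightarrow> 'q graded_alg \<Rightarrow> ('p \<Rightarrow> 'q) \<Rightarrow> bool" where
  "homogeneous_map A B f \<longleftrightarrow> (\<forall>i. \<exists>j. f ` component A i \<subseteq> component B j)"

definition algebra_retract ::
  "('x, 'k::field) mpoly graded_alg \<Rightarrow> ('y, 'k) mpoly graded_alg \<Rightarrow> bool" where
  "algebra_retract A B \<longleftrightarrow>
     (\<exists>\<iota> \<pi>. alg_hom A B \<iota> \<and> homogeneous_map A B \<iota> \<and> inj_on \<iota> (carr A) \<and>
            alg_hom B A \<pi> \<and> homogeneous_map B A \<pi> \<and> \<pi> ` carr B = carr A \<and>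
            (\<forall>p\<in>carr A. \<pi> (\<iota> p) = p))"

section \<open>Cut algebras\<close>

text \<open>
  The unordered partition \<open>A|B\<close> is the set \<open>{A, B}\<close>; the trivial partition is \<open>{{}, V}\<close>.
\<close>

definition partitions :: "'a set \<Rightarrow> 'a set set set" where
  "partitions V = {{A, B} | A B. A \<union> B = V \<and> A \<inter> B = {}}"

definition Cut :: "'a graph \<Rightarrow> 'a set set \<Rightarrow> 'a set set" where
  "Cut G P = {e \<in> edges G. \<exists>A B i j. P = {A, B} \<and> i \<in> A \<and> j \<in> B \<and> e = {i, j}}"

text \<open>The variables \<open>s\<^sub>e\<close> and \<open>t\<^sub>e\<close>, indexed by the edges \<open>e = {i, j}\<close>.\<close>

datatype 'a edge_var = S "'a set" | T "'a set"

definition cut_monomial :: "'a graph \<Rightarrow> 'a set set \<Rightarrow> ('a edge_var, 'k::field) mpoly" where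
  "cut_monomial G P = (\<Prod>e\<in>Cut G P. Var (S e)) * (\<Prod>e\<in>edges G - Cut G P. Var (T e))"

definition cut_map ::
  "'a graph \<Rightarrow> ('a set set, 'k::field) mpoly \<Rightarrow> ('a edge_var, 'k) mpoly" where
  "cut_map G = subst (cut_monomial G)"

text \<open>
  The image of \<open>cut_map G\<close> with the grading inherited from the standard grading of the source.
  Without edges every cut monomial is \<open>1\<close>, and the algebra is concentrated in degree \<open>0\<close>.
\<close>

definition cut_algebra :: "'a graph \<Rightarrow> ('a edge_var, 'k::field) mpoly graded_alg" where
  "cut_algebra G =
     Graded (cut_map G ` polys (partitions (verts G)))
       (\<lambda>d. if edges G = {} then (if d = 0 then range Const else {0})
            else cut_map G ` homog_polys (partitions (verts G)) d)"

end

theory Submission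
  imports Defs
begin

text \<open>
  Let \<open>H = G\<^sub>W\<close> with centre \<open>v\<close>. Restricting partitions to \<open>W\<close> is induced by the specialization
  that sets to \<open>1\<close> all variables of edges outside \<open>H\<close>; this gives \<open>\<pi>\<close>. For \<open>\<iota>\<close>, put \<open>W'\<close> on
  the side of \<open>v\<close>. Then an edge inside \<open>W' \<union> {v}\<close> is never cut, and an edge \<open>{w, w'}\<close> with
  \<open>w \<in> W - {v}\<close>, \<open>w' \<in> W'\<close> is cut exactly when the edge \<open>{v, w}\<close> of \<open>H\<close> is. So extension of
  partitions is induced by the substitution multiplying \<open>s\<^sub>v\<^sub>w\<close> and \<open>t\<^sub>v\<^sub>w\<close> by the variables of the
  edges from \<open>w\<close> to \<open>W'\<close>, with the constant factor coming from the uncut edges put on one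
  chosen edge of \<open>H\<close>. If \<open>H\<close> has no edges, \<open>\<K>[H]\<close> is the field of constants and the claim is trivial.
\<close>

section \<open>Substitution homomorphisms\<close>

lemma Const_0 [simp]: "Const 0 = 0"
  and Const_1 [simp]: "Const 1 = 1"
  by (simp_all add: Const_def)

lemma Const_add: "Const (a + b) = Const a + Const b"
  by (simp add: Const_def single_add)

lemma Const_mult: "Const (a * b) = Const a * Const b"
  by (simp add: Const_def mult_single)

lemma Const_sum: "Const (sum f A) = (\<Sum>x\<in>A. Const (f x))"
  by (induction A rule: infinite_finite_induct) (simp_all add: Const_add)

definition subst_monom :: "('x \<Rightarrow> ('y, 'k) mpoly) \<Rightarrow> ('x \<Rightarrow>\<^sub>0 nat) \<Rightarrow> ('y, 'k::field) mpoly" where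
  "subst_monom g m = (\<Prod>x\<in>Poly_Mapping.keys m. g x ^ Poly_Mapping.lookup m x)"

text \<open>Exponents vanish off the support, so the extra factors are \<open>g x ^ 0 = 1\<close>.
  This lets several exponent vectors with different supports be compared over one index set.\<close>

lemma subst_monom_superset:
  assumes "finite F" "Poly_Mapping.keys m \<subseteq> F"
  shows "subst_monom g m = (\<Prod>x\<in>F. g x ^ Poly_Mapping.lookup m x)"
  unfolding subst_monom_def
  by (rule prod.mono_neutral_left) (use assms in \<open>auto simp: in_keys_iff\<close>)

lemma subst_monom_add: "subst_monom g (m + n) = subst_monom g m * subst_monom g n"
proof -
  let ?F = "Poly_Mapping.keys m \<union> Poly_Mapping.keys n"
  have "subst_monom g k = (\<Prod>x\<in>?F. g x ^ Poly_Mapping.lookup k x)" if "k \<in> {m, n, m + n}" for k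
    by (rule subst_monom_superset) (use that keys_add[of m n] in auto)
  then show ?thesis
    by (simp add: lookup_add power_add prod.distrib)
qed

lemma subst_superset:
  assumes "finite F" "Poly_Mapping.keys p \<subseteq> F"
  shows "subst g p = (\<Sum>m\<in>F. Const (Poly_Mapping.lookup p m) * subst_monom g m)"
  unfolding subst_def subst_monom_def
  by (rule sum.mono_neutral_left) (use assms in \<open>auto simp: in_keys_iff\<close>)

lemma subst_add: "subst g (p + q) = subst g p + subst g q"
proof -
  let ?F = "Poly_Mapping.keys p \<union> Poly_Mapping.keys q"
  have "subst g r = (\<Sum>m\<in>?F. Const (Poly_Mapping.lookup r m) * subst_monom g m)"
    if "r \<in> {p, q, p + q}" for r
    by (rule subst_superset) (use that keys_add[of p q] in auto)
  then show ?thesis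
    by (simp add: lookup_add Const_add sum.distrib distrib_right)
qed

lemma subst_0 [simp]: "subst g 0 = 0"
  by (simp add: subst_def)

lemma subst_single: "subst g (Poly_Mapping.single m c) = Const c * subst_monom g m"
  by (subst subst_superset[of "{m}"]) auto

lemma subst_Const [simp]: "subst g (Const c) = Const c"
  by (simp add: Const_def subst_single subst_monom_def)

lemma subst_1 [simp]: "subst g 1 = 1"
  using subst_Const[of g 1] by simp

lemma subst_Var [simp]: "subst g (Var x) = g x"
  by (simp add: Var_def subst_single subst_monom_def)

text \<open>Every polynomial is a finite sum of terms, so identities additive in \<open>p\<close>
  need checking on single terms only.\<close>

lemma poly_mapping_add_induct [case_names single add]:
  fixes p :: "'x \<Rightarrow>\<^sub>0 'k::comm_monoid_add"
  assumes "\<And>m c. P (Poly_Mapping.single m c)" and "\<And>p q. P p \<Longrightarrow> P q \<Longrightarrow> P (p + q)"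
  shows "P p"
proof -
  have "P (\<Sum>m\<in>A. Poly_Mapping.single m (Poly_Mapping.lookup p m))" for A
    \<comment> \<open>The term with coefficient \<open>0\<close> is the zero polynomial, which
      covers the empty sum and the default value of sums over infinite sets.\<close>
    using assms(1)[of _ 0]
    by (induction A rule: infinite_finite_induct) (auto intro: assms)
  moreover have "(\<Sum>m\<in>Poly_Mapping.keys p. Poly_Mapping.single m (Poly_Mapping.lookup p m)) = p"
    by (rule poly_mapping_eqI)
       (auto simp: lookup_sum lookup_single when_def in_keys_iff sum.delta' cong: if_cong)
  ultimately show ?thesis by metis
qed

text \<open>Both sides are additive in \<open>p\<close> and in \<open>q\<close>, which leaves
  products of two terms; there \<open>subst_monom_add\<close> applies.\<close>

lemma subst_mult: "subst g (p * q) = subst g p * subst g q"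
proof (induction p rule: poly_mapping_add_induct)
  case (single m c)
  show ?case
  proof (induction q rule: poly_mapping_add_induct)
    case (single n d)
    show ?case
      by (simp add: mult_single subst_single subst_monom_add Const_mult)
  next
    case (add q q')
    then show ?case by (simp add: distrib_left subst_add)
  qed
next
  case (add p p')
  then show ?case by (simp add: distrib_right subst_add)
qed

lemma subst_prod: "subst g (prod f A) = (\<Prod>x\<in>A. subst g (f x))"
  by (induction A rule: infinite_finite_induct) (simp_all add: subst_mult)

lemma subst_power: "subst g (p ^ n) = subst g p ^ n"
  by (induction n) (simp_all add: subst_mult)

lemma subst_subst: "subst g (subst h p) = subst (\<lambda>x. subst g (h x)) p"
proof (induction p rule: poly_mapping_add_induct)
  case (single m c)
  show ?case
    by (simp add: subst_single subst_mult subst_monom_def subst_prod subst_power)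
qed (simp add: subst_add)

lemma subst_cong:
  assumes "p \<in> polys X" "\<And>x. x \<in> X \<Longrightarrow> g x = h x"
  shows "subst g p = subst h p"
  unfolding subst_def
  by (intro sum.cong prod.cong arg_cong2[where f = "(*)"] refl)
     (use assms in \<open>auto simp: polys_def subset_eq\<close>)

section \<open>Graded pieces\<close>

lemma mon_degree_add: "mon_degree (m + n) = mon_degree m + mon_degree n"
proof -
  let ?F = "Poly_Mapping.keys m \<union> Poly_Mapping.keys n"
  have "mon_degree k = (\<Sum>x\<in>?F. Poly_Mapping.lookup k x)" if "k \<in> {m, n, m + n}" for k
    unfolding mon_degree_def
    by (rule sum.mono_neutral_left) (use that keys_add[of m n] in \<open>auto simp: in_keys_iff\<close>)
  then show ?thesis
    by (simp add: lookup_add sum.distrib)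
qed

lemma Const_in_homog_polys [simp]: "Const c \<in> homog_polys X 0"
  by (auto simp: homog_polys_def polys_def Const_def mon_degree_def split: if_splits)

lemma zero_in_homog_polys [simp]: "0 \<in> homog_polys X d"
  by (simp add: homog_polys_def polys_def)

lemma Var_in_homog_polys: "x \<in> X \<Longrightarrow> Var x \<in> homog_polys X 1"
  by (auto simp: homog_polys_def polys_def Var_def mon_degree_def)

lemma add_in_polys: "p \<in> polys X \<Longrightarrow> q \<in> polys X \<Longrightarrow> p + q \<in> polys X"
  using keys_add[of p q] by (fastforce simp: polys_def)

lemma add_in_homog_polys:
  "p \<in> homog_polys X d \<Longrightarrow> q \<in> homog_polys X d \<Longrightarrow> p + q \<in> homog_polys X d"
  using keys_add[of p q] by (fastforce simp: homog_polys_def add_in_polys)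

lemma mult_in_polys:
  assumes "p \<in> polys X" "q \<in> polys X"
  shows "p * q \<in> polys X"
  unfolding polys_def
proof (rule CollectI, rule ballI)
  fix m assume "m \<in> Poly_Mapping.keys (p * q)"
  then obtain a b where "m = a + b" "a \<in> Poly_Mapping.keys p" "b \<in> Poly_Mapping.keys q"
    using keys_mult[of p q] by auto
  then show "Poly_Mapping.keys m \<subseteq> X"
    using assms keys_add[of a b] by (auto simp: polys_def subset_eq)
qed

lemma mult_in_homog_polys:
  assumes "p \<in> homog_polys X d" "q \<in> homog_polys X e"
  shows "p * q \<in> homog_polys X (d + e)"
  using assms keys_mult[of p q] by (fastforce simp: homog_polys_def mult_in_polys mon_degree_add)

lemma homog_polys_subset_polys: "homog_polys X d \<subseteq> polys X"
  by (auto simp: homog_polys_def)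

lemma Const_in_polys [simp]: "Const c \<in> polys X"
  using Const_in_homog_polys homog_polys_subset_polys by blast

lemma sum_in_polys: "(\<And>i. i \<in> A \<Longrightarrow> f i \<in> polys X) \<Longrightarrow> sum f A \<in> polys X"
  by (induction A rule: infinite_finite_induct) (use Const_in_polys[of 0] in \<open>simp_all add: add_in_polys\<close>)

lemma sum_in_homog_polys:
  "(\<And>i. i \<in> A \<Longrightarrow> f i \<in> homog_polys X d) \<Longrightarrow> sum f A \<in> homog_polys X d"
  by (induction A rule: infinite_finite_induct) (simp_all add: add_in_homog_polys)

lemma power_in_polys: "p \<in> polys X \<Longrightarrow> p ^ n \<in> polys X"
  by (induction n) (use Const_in_polys[of 1] in \<open>simp_all add: mult_in_polys\<close>)

lemma power_in_homog_polys: "p \<in> homog_polys X 1 \<Longrightarrow> p ^ n \<in> homog_polys X n"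
proof (induction n)
  case 0
  show ?case using Const_in_homog_polys[of 1] by simp
next
  case (Suc n)
  then show ?case using mult_in_homog_polys[of p X 1 "p ^ n" n] by simp
qed

lemma prod_in_polys: "(\<And>i. i \<in> A \<Longrightarrow> f i \<in> polys X) \<Longrightarrow> prod f A \<in> polys X"
  by (induction A rule: infinite_finite_induct) (use Const_in_polys[of 1] in \<open>simp_all add: mult_in_polys\<close>)

lemma prod_in_homog_polys:
  assumes "finite A" "\<And>i. i \<in> A \<Longrightarrow> f i \<in> homog_polys X (d i)"
  shows "prod f A \<in> homog_polys X (sum d A)"
  using assms
proof (induction A rule: finite_induct)
  case empty
  show ?case using Const_in_homog_polys[of 1] by simp
qed (simp add: mult_in_homog_polys)

lemma subst_in_polys:
  assumes "p \<in> polys X" "\<And>x. x \<in> X \<Longrightarrow> g x \<in> polys Y"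
  shows "subst g p \<in> polys Y"
  unfolding subst_def
  by (intro sum_in_polys mult_in_polys prod_in_polys power_in_polys Const_in_polys assms(2))
     (use assms(1) in \<open>auto simp: polys_def\<close>)

text \<open>Replacing each variable by a form of degree 1 turns a monomial of degree d into a form
  of degree d.\<close>

lemma subst_in_homog_polys:
  assumes "p \<in> homog_polys X d" "\<And>x. x \<in> X \<Longrightarrow> g x \<in> homog_polys Y 1"
  shows "subst g p \<in> homog_polys Y d"
  unfolding subst_def
proof (rule sum_in_homog_polys)
  fix m assume m: "m \<in> Poly_Mapping.keys p"
  have "(\<Prod>x\<in>Poly_Mapping.keys m. g x ^ Poly_Mapping.lookup m x) \<in> homog_polys Y (mon_degree m)"
    unfolding mon_degree_def
    by (intro prod_in_homog_polys power_in_homog_polys assms(2) finite_keys)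
       (use m assms(1) in \<open>auto simp: homog_polys_def polys_def\<close>)
  moreover have "mon_degree m = d"
    using m assms(1) by (simp add: homog_polys_def)
  ultimately show "Const (Poly_Mapping.lookup p m) *
      (\<Prod>x\<in>Poly_Mapping.keys m. g x ^ Poly_Mapping.lookup m x) \<in> homog_polys Y d"
    using mult_in_homog_polys[OF Const_in_homog_polys] by fastforce
qed

section \<open>Maps between cut algebras\<close>

text \<open>With exactly one factor per edge, substitutions into a cut monomial can be compared edge
  by edge.\<close>

lemma cut_monomial_if:
  assumes "finite (edges G)"
  shows "cut_monomial G P = (\<Prod>e\<in>edges G. if e \<in> Cut G P then Var (S e) else Var (T e))"
proof -
  have "Cut G P \<subseteq> edges G" by (auto simp: Cut_def)
  with assms show ?thesis
    by (simp add: cut_monomial_def prod.If_cases Int_absorb1 flip: Diff_eq)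
qed

lemma in_Cut_iff: "e \<in> Cut G {A, B} \<longleftrightarrow> e \<in> edges G \<and> (\<exists>i\<in>A. \<exists>j\<in>B. e = {i, j})"
  unfolding Cut_def by (auto simp: doubleton_eq_iff)

text \<open>Since \<open>B\<close> is the complement of \<open>A\<close> in \<open>V\<close>, being
  cut depends on membership in \<open>A\<close> alone.\<close>

lemma Cut_doubleton_edge_iff:
  assumes "{i, j} \<in> edges G" "i \<noteq> j" "A \<union> B = V" "A \<inter> B = {}" "i \<in> V" "j \<in> V"
  shows "{i, j} \<in> Cut G {A, B} \<longleftrightarrow> (i \<in> A \<longleftrightarrow> j \<notin> A)"
  using assms by (auto simp: in_Cut_iff doubleton_eq_iff)

text \<open>A substitution of edge variables that acts on cut monomials through a map
  \<open>r\<close> of partitions lifts to the renaming of the variables \<open>q\<close> by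
  \<open>r\<close>. Well-definedness modulo the kernel of \<open>cut_map\<close> thus never has to
  be checked.\<close>

lemma subst_cut_map:
  assumes p: "p \<in> polys (partitions (verts A))"
    and g: "\<And>P. P \<in> partitions (verts A) \<Longrightarrow> subst g (cut_monomial A P) = cut_monomial B (r P)"
  shows "subst g (cut_map A p) = cut_map B (subst (\<lambda>P. Var (r P)) p)"
  using subst_cong[OF p g] by (simp add: cut_map_def subst_subst)

lemma cut_map_edgeless:
  assumes "edges G = {}"
  shows "cut_map G p \<in> range Const"
  by (simp add: cut_map_def subst_def cut_monomial_def Cut_def assms flip: Const_sum)

lemma Const_in_cut_algebra:
  "Const c \<in> carr (cut_algebra G)" "Const c \<in> component (cut_algebra G) 0"
  unfolding cut_algebra_def
  by (auto simp: cut_map_def intro!: rev_image_eqI[of "Const c"])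

lemma zero_in_component: "0 \<in> component (cut_algebra G) d"
  unfolding cut_algebra_def
  by (auto simp: cut_map_def intro!: rev_image_eqI[of 0])

lemma component_subset_carr: "component (cut_algebra G) d \<subseteq> carr (cut_algebra G)"
proof (cases "edges G = {}")
  case True
  then show ?thesis
    using Const_in_cut_algebra(1)[of 0 G] Const_in_cut_algebra(1)[of _ G]
    by (auto simp: cut_algebra_def)
next
  case False
  then show ?thesis
    using homog_polys_subset_polys by (auto simp: cut_algebra_def)
qed

lemma carr_edgeless:
  assumes "edges G = {}"
  shows "carr (cut_algebra G) = component (cut_algebra G) 0"
proof
  show "carr (cut_algebra G) \<subseteq> component (cut_algebra G) 0"
    using assms by (auto simp: cut_algebra_def cut_map_edgeless)
qed (rule component_subset_carr)

lemma alg_hom_subst: "subst g ` carr A \<subseteq> carr B \<Longrightarrow> alg_hom A B (subst g)"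
  by (simp add: alg_hom_def subst_add subst_mult)

text \<open>The lifted renaming preserves degree, hence so does the induced map when both graphs
  have edges. The premise on \<open>edges\<close> ensures that if \<open>B\<close> has edges, both
  algebras carry the standard grading.\<close>

lemma cut_algebra_hom:
  assumes g: "\<And>P. P \<in> partitions (verts A) \<Longrightarrow> subst g (cut_monomial A P) = cut_monomial B (r P)"
    and r: "\<And>P. P \<in> partitions (verts A) \<Longrightarrow> r P \<in> partitions (verts B)"
    and edges: "edges A = {} \<Longrightarrow> edges B = {}"
  shows "alg_hom (cut_algebra A) (cut_algebra B) (subst g)"
    and "homogeneous_map (cut_algebra A) (cut_algebra B) (subst g)"
proof -
  have V: "Var (r P) \<in> homog_polys (partitions (verts B)) 1" if "P \<in> partitions (verts A)" for P
    using r[OF that] by (rule Var_in_homog_polys)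
  then have "Var (r P) \<in> polys (partitions (verts B))" if "P \<in> partitions (verts A)" for P
    using that homog_polys_subset_polys by blast
  then have carr_sub: "subst g ` carr (cut_algebra A) \<subseteq> carr (cut_algebra B)"
    unfolding cut_algebra_def by (auto simp: subst_cut_map[OF _ g] intro!: imageI subst_in_polys)
  from carr_sub show "alg_hom (cut_algebra A) (cut_algebra B) (subst g)"
    by (rule alg_hom_subst)
  have "\<exists>j. subst g ` component (cut_algebra A) d \<subseteq> component (cut_algebra B) j" for d
  proof (cases "edges B = {}")
    case True
    \<comment> \<open>If \<open>B\<close> has no edges, its whole algebra sits in degree 0, so every
      component lands there, whatever its degree \<open>d\<close>.\<close>
    have "subst g ` component (cut_algebra A) d \<subseteq> component (cut_algebra B) 0"
      using image_mono[OF component_subset_carr] carr_sub unfolding carr_edgeless[OF True]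
      by (rule subset_trans)
    then show ?thesis ..
  next
    case False
    then have "edges A \<noteq> {}" using edges by blast
    have "subst g (cut_map A p) \<in> cut_map B ` homog_polys (partitions (verts B)) d"
      if p: "p \<in> homog_polys (partitions (verts A)) d" for p
    proof -
      have "p \<in> polys (partitions (verts A))" using p homog_polys_subset_polys by blast
      then show ?thesis
        using subst_in_homog_polys[OF p V] by (simp add: subst_cut_map[OF _ g])
    qed
    then have "subst g ` component (cut_algebra A) d \<subseteq> component (cut_algebra B) d"
      using False \<open>edges A \<noteq> {}\<close> by (auto simp: cut_algebra_def)
    then show ?thesis ..
  qed
  then show "homogeneous_map (cut_algebra A) (cut_algebra B) (subst g)"
    by (simp add: homogeneous_map_def)
qed

text \<open>All elements of the source are constants, which any substitution fixes; \<open>g\<close>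
  is therefore arbitrary.\<close>

lemma edgeless_hom:
  assumes "edges A = {}"
  shows "alg_hom (cut_algebra A) (cut_algebra B) (subst g)"
    and "homogeneous_map (cut_algebra A) (cut_algebra B) (subst g)"
proof -
  have "subst g p \<in> carr (cut_algebra B)" if "p \<in> carr (cut_algebra A)" for p
  proof -
    have "p \<in> range Const"
      using that by (auto simp: cut_algebra_def cut_map_edgeless[OF assms])
    then show ?thesis by (auto simp: Const_in_cut_algebra)
  qed
  then have "subst g ` carr (cut_algebra A) \<subseteq> carr (cut_algebra B)"
    by blast
  then show "alg_hom (cut_algebra A) (cut_algebra B) (subst g)"
    by (rule alg_hom_subst)
  have "subst g ` component (cut_algebra A) d \<subseteq> component (cut_algebra B) d" for d
    by (auto simp: assms cut_algebra_def[of A] Const_in_cut_algebra zero_in_component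
        split: if_splits)
  then show "homogeneous_map (cut_algebra A) (cut_algebra B) (subst g)"
    unfolding homogeneous_map_def by blast
qed

lemma algebra_retractI:
  assumes "alg_hom A B f" "homogeneous_map A B f" "alg_hom B A h" "homogeneous_map B A h"
    and "\<And>p. p \<in> carr A \<Longrightarrow> h (f p) = p"
  shows "algebra_retract A B"
proof -
  have "inj_on f (carr A)" using assms(5) by (metis inj_onI)
  moreover have "h ` carr B = carr A"
  proof
    show "h ` carr B \<subseteq> carr A" using assms(3) by (simp add: alg_hom_def)
    have "f ` carr A \<subseteq> carr B" using assms(1) by (simp add: alg_hom_def)
    then show "carr A \<subseteq> h ` carr B" using assms(5) by (metis image_eqI image_subset_iff subsetI)
  qed
  ultimately show ?thesis
    unfolding algebra_retract_def using assms
    by (intro exI[of _ f] exI[of _ h] conjI ballI)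
qed

section \<open>Restriction and extension of partitions\<close>

definition restr_partition :: "'a set \<Rightarrow> 'a set set \<Rightarrow> 'a set set" where
  "restr_partition W P = (\<lambda>A. A \<inter> W) ` P"

text \<open>Acting block by block avoids ordering the two blocks; only the block containing
  \<open>v\<close> absorbs \<open>W'\<close>.\<close>

definition ext_partition :: "'a \<Rightarrow> 'a set \<Rightarrow> 'a set set \<Rightarrow> 'a set set" where
  "ext_partition v W' P = (\<lambda>A. if v \<in> A then A \<union> W' else A) ` P"

locale nbhd_minor =
  fixes G H :: "'a graph" and W W' :: "'a set" and v :: 'a
  assumes simple: "simple_graph G"
    and verts: "verts G = W \<union> W'" and disj: "W \<inter> W' = {}"
    and H: "H = induced_subgraph G W"
    and v: "v \<in> W" and nb: "W \<inter> set_nbrs G W' \<subseteq> closed_nbrs H v"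
begin

lemma verts_H [simp]: "verts H = W"
  by (simp add: H induced_subgraph_def)

lemma edges_H: "edges H = {e \<in> edges G. e \<subseteq> W}"
  by (simp add: H induced_subgraph_def)

lemma edge_cases:
  assumes "e \<in> edges G"
  obtains i j where "e = {i, j}" "i \<noteq> j" "i \<in> verts G" "j \<in> verts G"
  using assms simple unfolding simple_graph_def by (metis card_2_iff insert_subset)

lemma finite_edges: "finite (edges G)" "finite (edges H)"
proof -
  have "edges G \<subseteq> Pow (verts G)" "finite (verts G)"
    using simple by (auto simp: simple_graph_def)
  then show "finite (edges G)" by (meson finite_Pow_iff finite_subset)
  then show "finite (edges H)" by (simp add: edges_H)
qed

lemma restr_in_partitions:
  "P \<in> partitions (verts G) \<Longrightarrow> restr_partition W P \<in> partitions W"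
  unfolding partitions_def restr_partition_def verts
  \<comment> \<open>Solving the equation by \<open>refl\<close> fixes the two restricted blocks as
    witnesses.\<close>
  by clarsimp (rule exI, rule exI, rule conjI, rule refl, blast)

lemma partition_obtain:
  assumes "P \<in> partitions W"
  obtains A B where "P = {A, B}" "A \<union> B = W" "A \<inter> B = {}" "v \<in> A"
  using assms v unfolding partitions_def by blast

lemma ext_eq: "v \<in> A \<Longrightarrow> v \<notin> B \<Longrightarrow> ext_partition v W' {A, B} = {A \<union> W', B}"
  by (simp add: ext_partition_def insert_commute)

lemma ext_in_partitions:
  assumes "P \<in> partitions W"
  shows "ext_partition v W' P \<in> partitions (verts G)"
proof -
  obtain A B where AB: "P = {A, B}" "A \<union> B = W" "A \<inter> B = {}" "v \<in> A"
    using assms by (rule partition_obtain)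
  then have "ext_partition v W' P = {A \<union> W', B}"
    using ext_eq[of A B] by auto
  moreover have "(A \<union> W') \<union> B = verts G" "(A \<union> W') \<inter> B = {}"
    using AB verts disj by auto
  ultimately show ?thesis unfolding partitions_def by blast
qed

text \<open>Blocks of \<open>P\<close> lie in \<open>W\<close>, and the added set \<open>W'\<close>
  is disjoint from \<open>W\<close>, so intersecting with \<open>W\<close> recovers each
  block.\<close>

lemma restr_ext:
  assumes "P \<in> partitions W"
  shows "restr_partition W (ext_partition v W' P) = P"
proof -
  have "(if v \<in> A then A \<union> W' else A) \<inter> W = A" if "A \<in> P" for A
    using that assms disj by (auto simp: partitions_def)
  then show ?thesis
    by (simp add: restr_partition_def ext_partition_def image_image del: if_image_distrib
        cong: image_cong)
qed

lemma Cut_restr: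
  assumes P: "P \<in> partitions (verts G)" and e: "e \<in> edges H"
  shows "e \<in> Cut H (restr_partition W P) \<longleftrightarrow> e \<in> Cut G P"
proof -
  obtain A B where "P = {A, B}" using P by (auto simp: partitions_def)
  then show ?thesis
    using e by (auto simp: restr_partition_def in_Cut_iff edges_H)
qed

section \<open>Specialization inducing the restriction of partitions\<close>

fun restr_sub :: "'a edge_var \<Rightarrow> ('a edge_var, 'k::field) mpoly" where
  "restr_sub (S e) = (if e \<in> edges H then Var (S e) else 1)"
| "restr_sub (T e) = (if e \<in> edges H then Var (T e) else 1)"

lemma subst_restr_sub:
  assumes P: "P \<in> partitions (verts G)"
  shows "subst restr_sub (cut_monomial G P) = cut_monomial H (restr_partition W P)"
proof -
  let ?x = "\<lambda>e. if e \<in> Cut H (restr_partition W P) then Var (S e) else Var (T e)"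
  have "subst restr_sub (cut_monomial G P) =
      (\<Prod>e\<in>edges G. if e \<in> edges H then ?x e else 1)"
    unfolding cut_monomial_if[OF finite_edges(1)] subst_prod
    by (intro prod.cong) (auto simp: Cut_restr[OF P])
  also have "\<dots> = (\<Prod>e\<in>edges H. ?x e)"
    by (rule prod.mono_neutral_cong_right) (auto simp: finite_edges edges_H)
  finally show ?thesis
    by (simp add: cut_monomial_if[OF finite_edges(2)])
qed

section \<open>Substitution inducing the extension of partitions\<close>

definition uncut_edges :: "'a set set" where
  "uncut_edges = {e \<in> edges G. e \<subseteq> insert v W'}"

text \<open>The edge of \<open>H\<close> with which an edge of \<open>G\<close> is cut simultaneously by extended partitions.\<close>

definition anchor :: "'a set \<Rightarrow> 'a set" where
  "anchor e = (if e \<subseteq> W then e else insert v (e \<inter> W))"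

text \<open>An edge inside neither \<open>W\<close> nor \<open>insert v W'\<close> joins some
  \<open>w\<close> in \<open>W - {v}\<close> to \<open>W'\<close>. The neighborhood condition enters
  here: \<open>w\<close> is a neighbor of \<open>W'\<close>, hence of \<open>v\<close> in
  \<open>H\<close>.\<close>

lemma anchor_cases:
  assumes "e \<in> edges G - uncut_edges"
  obtains "e \<in> edges H" "anchor e = e"
  | w w' where "e = {w, w'}" "w \<in> W" "w \<noteq> v" "w' \<in> W'" "anchor e = {v, w}" "{v, w} \<in> edges H"
proof (cases "e \<subseteq> W")
  case True
  then show ?thesis using assms that(1) by (simp add: anchor_def edges_H)
next
  case False
  obtain i j where ij: "e = {i, j}" "i \<in> W \<union> W'" "j \<in> W \<union> W'"
    by (rule edge_cases[of e]) (use assms verts in auto)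
  have uncut: "\<not> e \<subseteq> insert v W'"
    using assms by (simp add: uncut_edges_def)
  obtain w w' where w: "e = {w, w'}" "w \<in> W" "w \<noteq> v" "w' \<in> W'"
  proof (cases "i \<in> W")
    case True
    show ?thesis by (rule that[of i j]) (use ij False uncut True in auto)
  next
    case notin: False
    show ?thesis by (rule that[of j i]) (use ij False uncut notin in auto)
  qed
  have "{w', w} \<in> edges G"
    using assms w(1) by (simp add: insert_commute)
  then have "w \<in> W \<inter> set_nbrs G W'"
    using w by (auto simp: set_nbrs_def nbrs_def)
  then have "{v, w} \<in> edges H"
    using nb w by (auto simp: closed_nbrs_def nbrs_def)
  moreover have "anchor e = {v, w}"
    using w disj by (auto simp: anchor_def)
  ultimately show ?thesis using that(2) w by blast
qed

lemma anchor_in_edges: "e \<in> edges G - uncut_edges \<Longrightarrow> anchor e \<in> edges H"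
  by (erule anchor_cases) simp_all

text \<open>For an edge of \<open>H\<close>, extension does not change the sides of its endpoints.
  For an edge from \<open>w\<close> to \<open>w'\<close> in \<open>W'\<close>, the vertex
  \<open>w'\<close> lies on the side of \<open>v\<close>, so \<open>w'\<close> and \<open>w\<close>
  are separated exactly when \<open>v\<close> and \<open>w\<close> are.\<close>

lemma Cut_ext:
  assumes P: "P \<in> partitions W" and e: "e \<in> edges G - uncut_edges"
  shows "e \<in> Cut G (ext_partition v W' P) \<longleftrightarrow> anchor e \<in> Cut H P"
proof -
  obtain A B where AB: "P = {A, B}" "A \<union> B = W" "A \<inter> B = {}" "v \<in> A"
    using P by (rule partition_obtain)
  then have ext: "ext_partition v W' P = {A \<union> W', B}"
    using ext_eq[of A B] by auto
  have AB': "(A \<union> W') \<union> B = verts G" "(A \<union> W') \<inter> B = {}"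
    using AB verts disj by auto
  show ?thesis
    using e
  proof (cases rule: anchor_cases)
    case 1
    then have "e \<in> edges G" "e \<subseteq> W" by (simp_all add: edges_H)
    then obtain i j where ij: "e = {i, j}" "i \<noteq> j" "i \<in> W" "j \<in> W"
      by (metis edge_cases insert_subset)
    have "e \<in> Cut G (ext_partition v W' P) \<longleftrightarrow> (i \<in> A \<union> W' \<longleftrightarrow> j \<notin> A \<union> W')"
      unfolding ext ij(1)
      by (rule Cut_doubleton_edge_iff[OF _ _ AB']) (use ij \<open>e \<in> edges G\<close> verts in auto)
    moreover have "e \<in> Cut H P \<longleftrightarrow> (i \<in> A \<longleftrightarrow> j \<notin> A)"
      unfolding AB(1) ij(1)
      by (rule Cut_doubleton_edge_iff[OF _ _ AB(2,3)]) (use ij 1 in auto)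
    moreover have "i \<notin> W'" "j \<notin> W'" using ij disj by auto
    ultimately show ?thesis using 1 by simp
  next
    case (2 w w')
    have "e \<in> Cut G (ext_partition v W' P) \<longleftrightarrow> (w \<in> A \<union> W' \<longleftrightarrow> w' \<notin> A \<union> W')"
      unfolding ext 2(1)
      by (rule Cut_doubleton_edge_iff[OF _ _ AB']) (use 2 e disj verts in auto)
    moreover have "anchor e \<in> Cut H P \<longleftrightarrow> (v \<in> A \<longleftrightarrow> w \<notin> A)"
      unfolding AB(1) 2(5)
      by (rule Cut_doubleton_edge_iff[OF _ _ AB(2,3)]) (use 2 v in auto)
    moreover have "w \<notin> W'" using 2 disj by auto
    ultimately show ?thesis using AB(4) 2(4) by simp
  qed
qed

text \<open>Both endpoints lie in the block \<open>A \<union> W'\<close>. Hence these edges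
  contribute the same product of \<open>T\<close> variables for every extended partition.\<close>

lemma uncut_edges_not_in_Cut:
  assumes P: "P \<in> partitions W" and e: "e \<in> uncut_edges"
  shows "e \<notin> Cut G (ext_partition v W' P)"
proof -
  obtain A B where AB: "P = {A, B}" "A \<union> B = W" "A \<inter> B = {}" "v \<in> A"
    using P by (rule partition_obtain)
  then have "ext_partition v W' P = {A \<union> W', B}"
    using ext_eq[of A B] by auto
  then show ?thesis
    using AB e disj by (auto simp: in_Cut_iff uncut_edges_def)
qed

text \<open>A cut monomial of \<open>H\<close> contains exactly one of \<open>S h0\<close> and
  \<open>T h0\<close> when \<open>h0\<close> is an edge of \<open>H\<close>. Attaching the product
  to both variables makes it occur exactly once.\<close>

definition uncut_factor :: "'a set \<Rightarrow> 'a set \<Rightarrow> ('a edge_var, 'k::field) mpoly" where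
  "uncut_factor h0 h = (if h = h0 then \<Prod>e\<in>uncut_edges. Var (T e) else 1)"

fun ext_sub :: "'a set \<Rightarrow> 'a edge_var \<Rightarrow> ('a edge_var, 'k::field) mpoly" where
  "ext_sub h0 (S h) =
     (\<Prod>e\<in>{e \<in> edges G - uncut_edges. anchor e = h}. Var (S e)) * uncut_factor h0 h"
| "ext_sub h0 (T h) =
     (\<Prod>e\<in>{e \<in> edges G - uncut_edges. anchor e = h}. Var (T e)) * uncut_factor h0 h"

lemma subst_ext_sub:
  assumes P: "P \<in> partitions W" and h0: "h0 \<in> edges H"
  shows "subst (ext_sub h0) (cut_monomial H P) =
    (cut_monomial G (ext_partition v W' P) :: ('a edge_var, 'k::field) mpoly)"
proof -
  let ?x = "\<lambda>e. if e \<in> Cut G (ext_partition v W' P) then Var (S e) else Var (T e) :: ('a edge_var, 'k) mpoly"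
  let ?F = "\<lambda>h. {e \<in> edges G - uncut_edges. anchor e = h}"
  have "subst (ext_sub h0) (cut_monomial H P) =
      (\<Prod>h\<in>edges H. (\<Prod>e\<in>?F h. ?x e) * uncut_factor h0 h)"
    unfolding cut_monomial_if[OF finite_edges(2)] subst_prod
  proof (rule prod.cong[OF refl])
    fix h assume "h \<in> edges H"
    have "(\<Prod>e\<in>?F h. ?x e) = (\<Prod>e\<in>?F h. if h \<in> Cut H P then Var (S e) else Var (T e))"
      by (rule prod.cong) (auto simp: Cut_ext[OF P])
    then show "subst (ext_sub h0) (if h \<in> Cut H P then Var (S h) else Var (T h)) =
        (\<Prod>e\<in>?F h. ?x e) * uncut_factor h0 h"
      by (cases "h \<in> Cut H P") simp_all
  qed
  also have "\<dots> = (\<Prod>h\<in>edges H. \<Prod>e\<in>?F h. ?x e) * (\<Prod>e\<in>uncut_edges. Var (T e))"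
    using h0 finite_edges by (simp add: prod.distrib uncut_factor_def)
  also have "(\<Prod>h\<in>edges H. \<Prod>e\<in>?F h. ?x e) = (\<Prod>e\<in>edges G - uncut_edges. ?x e)"
    \<comment> \<open>The fibres of \<open>anchor\<close> over the edges of \<open>H\<close>
      partition the remaining edges of \<open>G\<close>.\<close>
    by (rule prod.group) (use finite_edges anchor_in_edges in auto)
  also have "(\<Prod>e\<in>uncut_edges. Var (T e)) = (\<Prod>e\<in>uncut_edges. ?x e)"
    by (rule prod.cong) (simp_all add: uncut_edges_not_in_Cut[OF P])
  also have "(\<Prod>e\<in>edges G - uncut_edges. ?x e) * (\<Prod>e\<in>uncut_edges. ?x e) = (\<Prod>e\<in>edges G. ?x e)"
    by (rule prod.subset_diff[symmetric]) (auto simp: finite_edges uncut_edges_def)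
  finally show ?thesis
    by (simp add: cut_monomial_if[OF finite_edges(1)])
qed

lemma cut_algebra_retract:
  "algebra_retract (cut_algebra H :: ('a edge_var, 'k::field) mpoly graded_alg) (cut_algebra G)"
proof -
  have R: "alg_hom (cut_algebra G) (cut_algebra H) (subst restr_sub)"
    "homogeneous_map (cut_algebra G) (cut_algebra H) (subst restr_sub)"
    using cut_algebra_hom[of G restr_sub H "restr_partition W"]
    by (auto simp: subst_restr_sub restr_in_partitions edges_H)
  show ?thesis
  proof (cases "edges H = {}")
    case True
    \<comment> \<open>Only constants occur here, so \<open>Var\<close> is merely a convenient choice
      of substitution for the embedding.\<close>
    have "subst restr_sub (subst Var p) = p" if "p \<in> carr (cut_algebra H)" for p
    proof -
      have "p \<in> range Const"
        using that by (auto simp: cut_algebra_def cut_map_edgeless[OF True])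
      then show ?thesis by auto
    qed
    then show ?thesis
      by (rule algebra_retractI[OF edgeless_hom[OF True] R])
  next
    case False
    then obtain h0 where h0: "h0 \<in> edges H" by blast
    note g = subst_ext_sub[OF _ h0]
    have I: "alg_hom (cut_algebra H) (cut_algebra G) (subst (ext_sub h0))"
      "homogeneous_map (cut_algebra H) (cut_algebra G) (subst (ext_sub h0))"
      using cut_algebra_hom[of H "ext_sub h0" G "ext_partition v W'"] False
      by (auto simp: g ext_in_partitions)
    have "subst restr_sub (subst (ext_sub h0) q) = q" if carr: "q \<in> carr (cut_algebra H)" for q
    proof -
      obtain p where p: "p \<in> polys (partitions W)" and q: "q = subst (cut_monomial H) p"
        using carr by (auto simp: cut_algebra_def cut_map_def)
      \<comment> \<open>On generators the composite restricts an extended partition, which is the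
        identity by \<open>restr_ext\<close>. Agreement on generators suffices because
        \<open>q\<close> is a polynomial in them.\<close>
      have "subst restr_sub (subst (ext_sub h0) (cut_monomial H P)) = cut_monomial H P"
        if "P \<in> partitions W" for P
        using that by (simp add: g subst_restr_sub ext_in_partitions restr_ext)
      then show ?thesis
        unfolding q subst_subst by (rule subst_cong[OF p])
    qed
    then show ?thesis
      by (rule algebra_retractI[OF I R])
  qed
qed

end

theorem theorem5p4:
  fixes G H :: "'a graph"
  assumes "simple_graph G"
    and "neighborhood_minor H G"
  shows "algebra_retract (cut_algebra H :: ('a edge_var, 'k::field) mpoly graded_alg)
           (cut_algebra G)"
proof -
  obtain W W' v where "nbhd_minor G H W W' v"
    using assms unfolding neighborhood_minor_def nbhd_minor_def by blast
  then show ?thesis by (rule nbhd_minor.cut_algebra_retract)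
qed

end
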